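(* Let $s \ge 1$ and $n \ge 1$ be integers. The number of compositions of $n$ with specification \[ [1,2,\ldots,s] + [s,2+s-1] + [s,4+s-1] + [s,8+s-1] + \cdots \] is $a_s(n)$, the number of leaves among the first $n$ nodes of the infinite labelled tree $\mathcal{F}_s$. That is, $a_s(n)$ is the number of finite sequences $(x_0,x_1,\ldots,x_k)$, with $k \ge 0$ arbitrary, such that $x_0+x_1+\cdots+x_k=n$, $x_0\in\{1,2,\ldots,s\}$, and $x_i\in\{s,\,2^i+s-1\}$ for $1\le i\le k$.
   Context: For an integer $s \ge 0$, the infinite tree $\mathcal{F}_s$ is built as follows. It contains an initial single-node tree (one leaf); for each $h \ge 1$ a complete binary tree with $2^h-1$ nodes, called subtree $h$ (so the trees have sizes $1,1,3,7,15,\ldots$); and for each $h\ge 1$ a super-node $y_h$ consisting of $s$ ordinary nodes (no labelled nodes at all if $s=0$). The right child of $y_h$ is the root of subtree $h$; the left child of $y_h$ is $y_{h-1}$ if $h \ge 2$, and is the initial single-node tree if $h=1$. Labels $1,2,3,\ldots$ are given to the nodes in the following order: the initial single node, the $s$ nodes of $y_1$, the nodes of subtree $1$ in preorder, the $s$ nodes of $y_2$, the nodes of subtree $2$ in preorder, and so on. The leaves of $\mathcal{F}_s$ are the initial single node and the leaves of the subtrees $h\ge1$ (all at the bottom level); all other nodes, including those in super-nodes, are internal. For $n\ge 1$, $d_s(n)=1$ if node $n$ is a leaf and $d_s(n)=0$ otherwise; $d_s(0)=0$. Then $a_s(n)=\sum_{j=0}^n d_s(j)$ is the number of leaves among nodes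 $1,\ldots,n$. A specification $S_0+S_1+S_2+\cdots$ (each $S_i$ a finite set of positive integers) denotes the set of compositions $x_0+x_1+\cdots+x_k$, for some $k\ge0$, with $x_i\in S_i$ for $0\le i\le k$. *)

theory Defs
  imports Main
begin

text \<open>The vertices of \<open>F\<^sub>s\<close>: the initial single-node tree, the super-nodes \<open>y\<^sub>h\<close>, and the nodes of
  the complete binary trees.  \<open>Sub h p\<close> is the node of subtree \<open>h\<close> that is reached from its root by
  the path \<open>p\<close> (\<open>False\<close> is left, \<open>True\<close> is right).  Only \<open>h \<ge> 1\<close> and \<open>length p < h\<close> are
  meaningful.  A super-node is a single vertex here; it is its \<open>s\<close> ordinary nodes that carry labels,
  so it is listed \<open>s\<close> times in the labelling sequence below.\<close>

datatype vertex = Init | Super nat | Sub nat "bool list"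

fun left_child :: "vertex \<Rightarrow> vertex option" where
  "left_child Init = None"
| "left_child (Super h) = Some (if h \<ge> 2 then Super (h - 1) else Init)"
| "left_child (Sub h p) = (if length p + 1 < h then Some (Sub h (p @ [False])) else None)"

fun right_child :: "vertex \<Rightarrow> vertex option" where
  "right_child Init = None"
| "right_child (Super h) = Some (Sub h [])"
| "right_child (Sub h p) = (if length p + 1 < h then Some (Sub h (p @ [True])) else None)"

definition is_leaf :: "vertex \<Rightarrow> bool" where
  "is_leaf v \<longleftrightarrow> left_child v = None \<and> right_child v = None"

function preorder :: "vertex \<Rightarrow> vertex list" where
  "preorder v = v # (case left_child v of None \<Rightarrow> [] | Some u \<Rightarrow> preorder u)
                  @ (case right_child v of None \<Rightarrow> [] | Some u \<Rightarrow> preorder u)"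
  by auto
termination
proof (relation "measure (\<lambda>v. case v of Init \<Rightarrow> 0 | Super h \<Rightarrow> 2 * h + 1 | Sub h p \<Rightarrow> h - length p)")
  fix v u assume "left_child v = Some u"
  then show "(u, v) \<in> measure (\<lambda>v. case v of Init \<Rightarrow> 0 | Super h \<Rightarrow> 2 * h + 1 | Sub h p \<Rightarrow> h - length p)"
    by (cases v) (auto split: if_splits)
next
  fix v u assume "right_child v = Some u"
  then show "(u, v) \<in> measure (\<lambda>v. case v of Init \<Rightarrow> 0 | Super h \<Rightarrow> 2 * h + 1 | Sub h p \<Rightarrow> h - length p)"
    by (cases v) (auto split: if_splits)
qed simp

declare preorder.simps [simp del]

text \<open>The labelling order, up to and including subtree \<open>h\<close>.\<close>

fun labelling :: "nat \<Rightarrow> nat \<Rightarrow> vertex list" where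
  "labelling s 0 = [Init]"
| "labelling s (Suc h) =
     labelling s h @ replicate s (Super (Suc h)) @ preorder (Sub (Suc h) [])"

text \<open>The vertex that holds the node with label \<open>n \<ge> 1\<close>.  The lists \<open>labelling s h\<close> extend one another
  as \<open>h\<close> grows, and \<open>labelling s n\<close> has more than \<open>n\<close> entries, so stopping at stage \<open>n\<close> is no
  restriction; see \<open>vertex_of_label_eq\<close>.\<close>

definition vertex_of_label :: "nat \<Rightarrow> nat \<Rightarrow> vertex" where
  "vertex_of_label s n = labelling s n ! (n - 1)"

lemma length_labelling: "h < length (labelling s h)"
proof (induction h)
  case (Suc h)
  have "0 < length (preorder (Sub (Suc h) []))"
    by (subst preorder.simps) simp
  with Suc have "Suc h < length (labelling s h) + length (preorder (Sub (Suc h) []))"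
    by linarith
  then show ?case by simp
qed simp

lemma labelling_extends: "h \<le> h' \<Longrightarrow> \<exists>xs. labelling s h' = labelling s h @ xs"
  by (induction h' rule: dec_induct) auto

lemma vertex_of_label_eq:
  assumes "1 \<le> n" "n \<le> length (labelling s h)"
  shows "vertex_of_label s n = labelling s h ! (n - 1)"
proof (cases "h \<le> n")
  case True
  then show ?thesis
    using assms labelling_extends[of h n s] by (auto simp: vertex_of_label_def nth_append)
next
  case False
  then show ?thesis
    using assms labelling_extends[of n h s] length_labelling[of n s]
    by (auto simp: vertex_of_label_def nth_append)
qed

definition leaf_ind :: "nat \<Rightarrow> nat \<Rightarrow> nat" where
  "leaf_ind s n = (if n \<ge> 1 \<and> is_leaf (vertex_of_label s n) then 1 else 0)"

definition leaf_count :: "nat \<Rightarrow> nat \<Rightarrow> nat" where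
  "leaf_count s n = (\<Sum>j=0..n. leaf_ind s j)"

definition compositions_with_spec :: "(nat \<Rightarrow> nat set) \<Rightarrow> nat list set" where
  "compositions_with_spec S = {xs. xs \<noteq> [] \<and> (\<forall>i < length xs. xs ! i \<in> S i)}"

definition spec :: "nat \<Rightarrow> nat \<Rightarrow> nat set" where
  "spec s i = (if i = 0 then {1..s} else {s, 2 ^ i + s - 1})"

end

theory Submission imports Defs begin

text \<open>For a finite set \<open>A\<close> of positive integers put \<open>w(A) = (\<Sum>i\<in>A. 2 ^ i - 1)\<close>. Both sides count the
  sets \<open>A\<close> with \<open>s * max A + w(A) < n\<close> (where \<open>max {} = 0\<close>). On the tree side, with the initial node
  corresponding to the empty set, \<open>s * max A + w(A) + 1\<close> is the label of a leaf of subtree \<open>max A\<close>: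
  the elements \<open>i < max A\<close> record the right turns on the way to that leaf, each of which skips a
  subtree with \<open>2 ^ i - 1\<close> nodes. On the composition side, the choices of
  \<open>x\<^sub>1, \<dots>, x\<^sub>k\<close> are the sets \<open>A \<subseteq> {1..k}\<close>, and \<open>x\<^sub>0\<close> exists iff
  \<open>k * s + w(A) < n \<le> (k + 1) * s + w(A)\<close>; the sum over \<open>k\<close> telescopes.\<close>

text \<open>\<open>weight_count k m\<close> is the number of sets \<open>A \<subseteq> {1..k}\<close> with \<open>w(A) < m\<close>; the truncated subtraction
  is harmless because the count vanishes at \<open>m = 0\<close>.\<close>

fun weight_count :: "nat \<Rightarrow> nat \<Rightarrow> nat" where
  "weight_count 0 m = (if m = 0 then 0 else 1)"
| "weight_count (Suc k) m = weight_count k m + weight_count k (m - (2 ^ Suc k - 1))"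

lemma weight_count_0 [simp]: "weight_count k 0 = 0"
  by (induction k) auto

section \<open>Leaves in the labelling order\<close>

lemma preorder_Sub:
  "length p + 1 < h \<Longrightarrow> preorder (Sub h p) =
     Sub h p # preorder (Sub h (p @ [False])) @ preorder (Sub h (p @ [True]))"
  by (subst preorder.simps) simp

lemma length_preorder_Sub:
  "h = length p + Suc r \<Longrightarrow> length (preorder (Sub h p)) = 2 ^ Suc r - 1"
proof (induction r arbitrary: p)
  case 0
  then show ?case by (subst preorder.simps) simp
next
  case (Suc r)
  have "length (preorder (Sub h (p @ [b]))) = 2 ^ Suc r - 1" for b
    using Suc by simp
  then have "length (preorder (Sub h p)) = Suc (2 ^ Suc r - 1 + (2 ^ Suc r - 1))"
    using Suc.prems by (simp add: preorder_Sub)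
  moreover have "(1::nat) \<le> 2 ^ r"
    by simp
  ultimately show ?case
    unfolding power_Suc by linarith
qed

text \<open>The subtraction of \<open>r\<close> accounts for the internal nodes on the left spine,
  which precede the first leaf. Turning right at a node with \<open>i\<close> levels below it skips
  its left subtree of 2^i - 1 nodes, so the leaf whose right turns form the set A has position r +
  w(A) + 1.\<close>

lemma leaves_take_preorder_Sub:
  "h = length p + Suc r \<Longrightarrow>
     length (filter is_leaf (take m (preorder (Sub h p)))) = weight_count r (m - r)"
proof (induction r arbitrary: p m)
  case 0
  then show ?case
    by (subst preorder.simps) (auto simp: is_leaf_def take_Cons split: nat.splits)
next
  case (Suc r)
  show ?case
  proof (cases m)
    case 0
    then show ?thesis by simp
  next
    case m: (Suc m')
    have IH: "length (filter is_leaf (take l (preorder (Sub h (p @ [b]))))) = weight_count r (l - r)"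
      for b l
      using Suc by simp
    have len: "length (preorder (Sub h (p @ [False]))) = 2 ^ Suc r - 1"
      using Suc.prems by (intro length_preorder_Sub) simp
    have preorder_eq: "preorder (Sub h p) =
        Sub h p # preorder (Sub h (p @ [False])) @ preorder (Sub h (p @ [True]))"
      using Suc.prems by (intro preorder_Sub) simp
    have "\<not> is_leaf (Sub h p)"
      using Suc.prems by (simp add: is_leaf_def)
    then have leaves: "length (filter is_leaf (take m (preorder (Sub h p)))) =
        weight_count r (m' - r) + weight_count r (m' - (2 ^ Suc r - 1) - r)"
      by (simp only: m take_Suc_Cons take_append filter.simps if_False filter_append length_append
          len IH preorder_eq)
    have shift: "m' - d - r = m - Suc r - d" "m' - r = m - Suc r" for d
      by (simp_all add: m)
    show ?thesis
      unfolding weight_count.simps leaves shift ..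
  qed
qed

text \<open>The length is 1 plus the sum of s + 2^i - 1 over i = 1, ..., h; the additive form avoids
  truncated subtraction.\<close>

lemma length_labelling_eq: "length (labelling s h) + h + 1 = h * s + 2 ^ Suc h"
proof (induction h)
  case (Suc h)
  have "length (preorder (Sub (Suc h) [])) = 2 ^ Suc h - 1"
    by (rule length_preorder_Sub) simp
  moreover have "(1::nat) \<le> 2 ^ h"
    by simp
  moreover have "length (labelling s (Suc h)) =
      length (labelling s h) + s + length (preorder (Sub (Suc h) []))"
    by simp
  ultimately show ?case
    using Suc unfolding power_Suc mult_Suc by linarith
qed simp

text \<open>The added leaves belong to the sets with maximum \<open>Suc h\<close>. The earlier
  labels, the super-node and the \<open>h\<close> inner nodes of the left spine together give the
  offset \<open>Suc h * s + (2 ^ Suc h - 1)\<close>.\<close>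

lemma leaves_take_labelling_Suc:
  "length (filter is_leaf (take n (labelling s (Suc h)))) =
     length (filter is_leaf (take n (labelling s h))) +
     weight_count h (n - Suc h * s - (2 ^ Suc h - 1))"
proof -
  let ?l = "length (labelling s h)"
  have "filter is_leaf (take m (replicate s (Super (Suc h)))) = []" for m
    by (auto simp: is_leaf_def filter_empty_conv dest: in_set_takeD)
  moreover have "length (filter is_leaf (take m (preorder (Sub (Suc h) [])))) = weight_count h (m - h)"
    for m
    by (rule leaves_take_preorder_Sub) simp
  moreover have "n - ?l - s - h = n - Suc h * s - (2 ^ Suc h - 1)"
    using length_labelling_eq[of s h] by simp
  ultimately show ?thesis
    by simp
qed

lemma leaf_count_eq:
  assumes "n \<le> length (labelling s h)"
  shows "leaf_count s n = length (filter is_leaf (take n (labelling s h)))"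
  using assms
proof (induction n)
  case 0
  then show ?case by (simp add: leaf_count_def leaf_ind_def)
next
  case (Suc n)
  then show ?case
    by (simp add: leaf_count_def leaf_ind_def vertex_of_label_eq[of "Suc n" s h]
        take_Suc_conv_app_nth)
qed

section \<open>Compositions of fixed length\<close>

definition compositions_of_length :: "(nat \<Rightarrow> nat set) \<Rightarrow> nat \<Rightarrow> nat \<Rightarrow> nat list set" where
  "compositions_of_length S k n = {xs. length xs = k \<and> (\<forall>i<k. xs ! i \<in> S i) \<and> sum_list xs = n}"

lemma compositions_of_length_Suc:
  "compositions_of_length S (Suc k) n =
     (\<Union>x \<in> {x \<in> S k. x \<le> n}. (\<lambda>xs. xs @ [x]) ` compositions_of_length S k (n - x))" (is "_ = ?R")
proof
  show "compositions_of_length S (Suc k) n \<subseteq> ?R"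
  proof
    fix zs assume zs: "zs \<in> compositions_of_length S (Suc k) n"
    then obtain xs x where xs: "zs = xs @ [x]"
      by (auto simp: compositions_of_length_def length_Suc_conv_rev)
    with zs have "xs \<in> compositions_of_length S k (n - x)" "x \<in> S k" "x \<le> n"
      by (auto simp: compositions_of_length_def nth_append less_Suc_eq all_conj_distrib)
    with xs show "zs \<in> ?R" by blast
  qed
qed (auto simp: compositions_of_length_def nth_append less_Suc_eq)

lemma compositions_of_length_zero:
  assumes "0 \<notin> S 0"
  shows "compositions_of_length S (Suc k) 0 = {}"
proof -
  have False if "xs \<in> compositions_of_length S (Suc k) 0" for xs
  proof -
    from that have "xs ! 0 \<in> set xs" "sum_list xs = 0" "xs ! 0 \<in> S 0"
      by (auto simp: compositions_of_length_def)
    with assms show False by (metis sum_list_eq_0_iff)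
  qed
  then show ?thesis by blast
qed

lemma finite_compositions_of_length: "finite (compositions_of_length S k n)"
proof (induction k arbitrary: n)
  case 0
  then show ?case by (simp add: compositions_of_length_def)
next
  case (Suc k)
  have "finite {x \<in> S k. x \<le> n}"
    by (rule finite_subset[of _ "{..n}"]) auto
  with Suc show ?case
    by (simp add: compositions_of_length_Suc)
qed

lemma card_compositions_of_length_Suc:
  "card (compositions_of_length S (Suc k) n) =
     (\<Sum>x \<in> {x \<in> S k. x \<le> n}. card (compositions_of_length S k (n - x)))"
proof -
  have "finite {x \<in> S k. x \<le> n}"
    by (rule finite_subset[of _ "{..n}"]) auto
  then show ?thesis
    unfolding compositions_of_length_Suc
    by (subst card_UN_disjoint)
      (auto simp: finite_compositions_of_length card_image inj_on_def)
qed

lemma card_compositions_of_length_spec_1: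
  "card (compositions_of_length (spec s) (Suc 0) n) = (if 1 \<le> n \<and> n \<le> s then 1 else 0)"
proof -
  have "compositions_of_length (spec s) (Suc 0) n = (if 1 \<le> n \<and> n \<le> s then {[n]} else {})"
    by (auto simp: compositions_of_length_def spec_def length_Suc_conv)
  then show ?thesis by simp
qed

lemma card_compositions_of_length_spec_Suc:
  "card (compositions_of_length (spec s) (Suc (Suc k)) n) =
     card (compositions_of_length (spec s) (Suc k) (n - s)) +
     card (compositions_of_length (spec s) (Suc k) (n - s - (2 ^ Suc k - 1)))"
proof -
  let ?f = "\<lambda>m. card (compositions_of_length (spec s) (Suc k) m)"
  let ?y = "2 ^ Suc k + s - 1"
  have zero: "?f 0 = 0"
    by (simp add: compositions_of_length_zero spec_def)
  \<comment> \<open>The two choices for the last entry are distinct, so the sum has two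
    terms.\<close>
  have "s < ?y"
    using one_less_power[of "2::nat" "Suc k"] by simp
  have "?f (n - s) + ?f (n - ?y) = (\<Sum>x\<in>{s, ?y}. ?f (n - x))"
    using \<open>s < ?y\<close> by simp
  \<comment> \<open>For \<open>x > n\<close> the truncated \<open>n - x\<close> is 0, where
    \<open>?f\<close> vanishes.\<close>
  also have "\<dots> = (\<Sum>x\<in>{s, ?y}. if x \<le> n then ?f (n - x) else 0)"
    by (rule sum.cong) (simp_all add: zero)
  also have "\<dots> = (\<Sum>x\<in>{x \<in> {s, ?y}. x \<le> n}. ?f (n - x))"
    by (rule sum.inter_filter [symmetric]) simp
  also have "\<dots> = card (compositions_of_length (spec s) (Suc (Suc k)) n)"
    by (simp add: card_compositions_of_length_Suc[of _ "Suc k"] spec_def)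
  finally have "card (compositions_of_length (spec s) (Suc (Suc k)) n) = ?f (n - s) + ?f (n - ?y)" ..
  moreover have "n - ?y = n - s - (2 ^ Suc k - 1)"
    by simp
  ultimately show ?thesis by presburger
qed

text \<open>Splitting off the last entry gives all three terms the same recursion in
  \<open>k\<close>, once \<open>n\<close> is shifted by \<open>s\<close>.\<close>

lemma card_compositions_of_length_spec:
  "card (compositions_of_length (spec s) (Suc k) n) + weight_count k (n - Suc k * s) =
     weight_count k (n - k * s)"
proof (induction k arbitrary: n)
  case 0
  then show ?case by (auto simp: card_compositions_of_length_spec_1)
next
  case (Suc k)
  have shift: "n - s - d - Suc k * s = n - Suc (Suc k) * s - d" "n - s - d - k * s = n - Suc k * s - d"
    "n - s - Suc k * s = n - Suc (Suc k) * s" "n - s - k * s = n - Suc k * s" for d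
    by simp_all
  show ?case
    using Suc[of "n - s"] Suc[of "n - s - (2 ^ Suc k - 1)"]
    unfolding card_compositions_of_length_spec_Suc weight_count.simps shift
    by linarith
qed

text \<open>The weight count on the left is what remains of the telescoping sum after
  \<open>h\<close>.\<close>

lemma sum_card_compositions_of_length_spec:
  "(\<Sum>k\<le>h. card (compositions_of_length (spec s) (Suc k) n)) + weight_count h (n - Suc h * s) =
     length (filter is_leaf (take n (labelling s h)))"
proof (induction h)
  case 0
  then show ?case
    using card_compositions_of_length_spec[of s 0 n]
    by (auto simp: is_leaf_def take_Cons split: nat.splits)
next
  case (Suc h)
  then show ?case
    using card_compositions_of_length_spec[of s "Suc h" n]
    \<comment> \<open>Only this instance is split: one summand cancels the old remainder, the other
      counts the new leaves. The new remainder stays folded.\<close>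
    unfolding leaves_take_labelling_Suc sum.atMost_Suc weight_count.simps(2)[of h "n - Suc h * s"]
    by linarith
qed

section \<open>Summation over all lengths\<close>

lemma length_le_sum_list:
  fixes xs :: "nat list"
  shows "(\<And>x. x \<in> set xs \<Longrightarrow> 1 \<le> x) \<Longrightarrow> length xs \<le> sum_list xs"
  by (induction xs) (force simp: Suc_le_eq)+

lemma card_compositions_with_spec:
  assumes "\<And>i. 0 \<notin> S i"
  shows "card {xs \<in> compositions_with_spec S. sum_list xs = n} =
    (\<Sum>k\<le>n. card (compositions_of_length S (Suc k) n))"
proof -
  have "{xs \<in> compositions_with_spec S. sum_list xs = n} =
    (\<Union>k\<le>n. compositions_of_length S (Suc k) n)" (is "?L = ?R")
  proof
    show "?L \<subseteq> ?R"
    proof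
      fix xs assume xs: "xs \<in> ?L"
      then have "1 \<le> x" if "x \<in> set xs" for x
        using that assms
        by (metis (no_types, lifting) One_nat_def Suc_leI compositions_with_spec_def gr0I
            in_set_conv_nth mem_Collect_eq)
      then have "length xs \<le> n"
        using xs length_le_sum_list by blast
      with xs have "length xs - 1 \<le> n" "xs \<in> compositions_of_length S (Suc (length xs - 1)) n"
        by (auto simp: compositions_with_spec_def compositions_of_length_def)
      then show "xs \<in> ?R" by blast
    qed
  qed (auto simp: compositions_with_spec_def compositions_of_length_def)
  moreover have "compositions_of_length S k n \<inter> compositions_of_length S l n = {}" if "k \<noteq> l" for k l
    using that by (auto simp: compositions_of_length_def)
  ultimately show ?thesis
    by (simp add: card_UN_disjoint finite_compositions_of_length)
qed

theorem corollary2p14: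
  fixes s n :: nat
  assumes "s \<ge> 1" and "n \<ge> 1"
  shows "card {xs \<in> compositions_with_spec (spec s). sum_list xs = n} = leaf_count s n"
proof -
  have "2 ^ i + s - 1 \<noteq> 0" for i
    using assms(1) one_le_power[of "2::nat" i] by linarith
  then have "0 \<notin> spec s i" for i
    using assms(1) by (simp add: spec_def)
  then have "card {xs \<in> compositions_with_spec (spec s). sum_list xs = n} =
      (\<Sum>k\<le>n. card (compositions_of_length (spec s) (Suc k) n))"
    by (rule card_compositions_with_spec)
  \<comment> \<open>Since \<open>s\<close> is positive, the remainder vanishes at
    \<open>h = n\<close>.\<close>
  moreover have "n * 1 \<le> Suc n * s"
    using assms(1) by (intro mult_le_mono) simp_all
  then have "n - Suc n * s = 0"
    by linarith
  ultimately show ?thesis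
    using sum_card_compositions_of_length_spec[of s n n] leaf_count_eq[of n s n]
      length_labelling[of n s]
    by simp
qed

end
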